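(* Let $n,r,s\ge 1$ be integers and $k=2rs+r+s$, so that $2k+1=(2r+1)(2s+1)$. If $G\in\mathcal G_{2n+1}(2r+1,2s+1)$ (defined below), then $\chi_{la}(G)=3$.
   Context: For a graph $G$ with $q$ edges, a bijection $f:E(G)\to\{1,\dots,q\}$ is a local antimagic labeling if $f^+(u)\neq f^+(v)$ for every edge $uv$, where $f^+(u)$ is the sum of the labels of edges incident to $u$; $\chi_{la}(G)$ is the minimum number of distinct values of $f^+$ over all local antimagic labelings of $G$. Definition of $\mathcal G_{2n+1}(2r+1,2s+1)$. Let $E=4k+2$. Let $\Gamma$ be the graph with vertices $u_i,v_i,x_{i,j}$ ($1\le i\le 2k+1$, $1\le j\le 2n+1$) and edges $u_iv_i,u_ix_{i,j},v_ix_{i,j}$; thus $\Gamma$ is $2k+1$ disjoint copies of $P_2\vee O_{2n+1}$. Define the bijection $f:E(\Gamma)\to[1,(2k+1)(4n+3)]$ by, for every $1\le i\le 2k+1$: $f(u_iv_i)=i$, $f(v_ix_{i,1})=4k+3-i$, $f(u_ix_{i,2n+1})=2k+2-i+(n+1)E$, and for each $t\in\{1,\dots,n\}$: $f(u_ix_{i,2n-2t+1})=6k+4-i+(n+t)E$, $f(u_ix_{i,2n-2t+2})=2k+1+i+(n+t)E$, $f(v_ix_{i,2t})=2k+2-i+tE$, $f(v_ix_{i,2t+1})=2k+1+i+tE$. Let $\sigma_j(i)=f(u_ix_{i,j})+f(v_ix_{i,j})$. The class $\mathcal G_{2n+1}(2r+1,2s+1)$ consists of all graphs obtained from $\Gamma$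 as follows: for each $j\in[1,2n+1]$ choose (independently) a partition of $\{1,\dots,2k+1\}$ into $2r+1$ blocks, each of size $2s+1$, such that $\sum_{i\in B}\sigma_j(i)=(2s+1)[(8k+5)+2n(4k+2)]$ for each block $B$; then for each $j$ and each block $B$ of the $j$-th partition, identify the vertices $x_{i,j}$, $i\in B$, into a single vertex (adjacent to $u_i,v_i$ for $i\in B$, hence of degree $2(2s+1)$). *)

theory Defs
  imports Main "HOL-Library.Extended_Nat" "HOL-Library.Disjoint_Sets"
begin

text \<open>An edge between \<open>u\<close> and \<open>v\<close> is the set \<open>{u, v}\<close>.\<close>

record 'a ugraph =
  verts :: "'a set"
  edges :: "'a set set"

definition graph_iso :: "'a ugraph \<Rightarrow> 'b ugraph \<Rightarrow> bool" where
  "graph_iso G H \<longleftrightarrow>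
     (\<exists>\<phi>. bij_betw \<phi> (verts G) (verts H) \<and> edges H = (\<lambda>e. \<phi> ` e) ` edges G)"

definition vertex_sum :: "'a ugraph \<Rightarrow> ('a set \<Rightarrow> nat) \<Rightarrow> 'a \<Rightarrow> nat" where
  "vertex_sum G f u = (\<Sum>e\<in>{e \<in> edges G. u \<in> e}. f e)"

definition local_antimagic :: "'a ugraph \<Rightarrow> ('a set \<Rightarrow> nat) \<Rightarrow> bool" where
  "local_antimagic G f \<longleftrightarrow>
     bij_betw f (edges G) {1..card (edges G)} \<and>
     (\<forall>u v. {u, v} \<in> edges G \<longrightarrow> vertex_sum G f u \<noteq> vertex_sum G f v)"

text \<open>The minimum is taken in \<^typ>\<open>enat\<close>, so it is \<open>\<infinity>\<close> if there is no local antimagic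
  labeling; a finite value asserts that it is attained.\<close>

definition chi_la :: "'a ugraph \<Rightarrow> enat" where
  "chi_la G = (INF f \<in> {f. local_antimagic G f}. enat (card (vertex_sum G f ` verts G)))"

datatype gvertex = Uv nat | Vv nat | Xv nat nat

definition Gamma :: "nat \<Rightarrow> nat \<Rightarrow> gvertex ugraph" where
  "Gamma n k =
     \<lparr> verts = {Uv i | i. i \<in> {1..2*k+1}} \<union> {Vv i | i. i \<in> {1..2*k+1}}
             \<union> {Xv i j | i j. i \<in> {1..2*k+1} \<and> j \<in> {1..2*n+1}},
       edges = {{Uv i, Vv i} | i. i \<in> {1..2*k+1}}
             \<union> {{Uv i, Xv i j} | i j. i \<in> {1..2*k+1} \<and> j \<in> {1..2*n+1}}
             \<union> {{Vv i, Xv i j} | i j. i \<in> {1..2*k+1} \<and> j \<in> {1..2*n+1}} \<rparr>"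

text \<open>The labeling \<open>f\<close> of the edges of \<open>\<Gamma>\<close> is first given as a relation, clause by clause with
  \<open>E = 4k + 2\<close>; \<open>Gamma_label_eqs\<close> and \<open>bij_betw_Gamma_label\<close> below confirm
  that this determines a bijection on \<open>E(\<Gamma>)\<close>. No subtraction on \<^typ>\<open>nat\<close> truncates.\<close>

inductive Gamma_label_rel :: "nat \<Rightarrow> nat \<Rightarrow> gvertex set \<Rightarrow> nat \<Rightarrow> bool" for n k :: nat where
  uv: "i \<in> {1..2*k+1} \<Longrightarrow> Gamma_label_rel n k {Uv i, Vv i} i"
| vx1: "i \<in> {1..2*k+1} \<Longrightarrow> Gamma_label_rel n k {Vv i, Xv i 1} (4*k+3-i)"
| ux_last: "i \<in> {1..2*k+1} \<Longrightarrow>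
    Gamma_label_rel n k {Uv i, Xv i (2*n+1)} (2*k+2-i + (n+1)*(4*k+2))"
| ux_odd: "i \<in> {1..2*k+1} \<Longrightarrow> t \<in> {1..n} \<Longrightarrow>
    Gamma_label_rel n k {Uv i, Xv i (2*n-2*t+1)} (6*k+4-i + (n+t)*(4*k+2))"
| ux_even: "i \<in> {1..2*k+1} \<Longrightarrow> t \<in> {1..n} \<Longrightarrow>
    Gamma_label_rel n k {Uv i, Xv i (2*n-2*t+2)} (2*k+1+i + (n+t)*(4*k+2))"
| vx_even: "i \<in> {1..2*k+1} \<Longrightarrow> t \<in> {1..n} \<Longrightarrow>
    Gamma_label_rel n k {Vv i, Xv i (2*t)} (2*k+2-i + t*(4*k+2))"
| vx_odd: "i \<in> {1..2*k+1} \<Longrightarrow> t \<in> {1..n} \<Longrightarrow>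
    Gamma_label_rel n k {Vv i, Xv i (2*t+1)} (2*k+1+i + t*(4*k+2))"

definition Gamma_label :: "nat \<Rightarrow> nat \<Rightarrow> gvertex set \<Rightarrow> nat" where
  "Gamma_label n k e = (THE m. Gamma_label_rel n k e m)"

lemma Gamma_label_rel_unique:
  assumes "Gamma_label_rel n k e m" "Gamma_label_rel n k e m'"
  shows "m = m'"
proof -
  define ux where "ux i j = (if j = 2*n+1 then 2*k+2-i + (n+1)*(4*k+2)
    else if odd j then 6*k+4-i + (n + (2*n+1-j) div 2)*(4*k+2)
    else 2*k+1+i + (n + (2*n+2-j) div 2)*(4*k+2))" for i j
  define vx where "vx i j = (if j = 1 then 4*k+3-i
    else if even j then 2*k+2-i + (j div 2)*(4*k+2)
    else 2*k+1+i + (j div 2)*(4*k+2))" for i j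
  have *: "(\<exists>i. e = {Uv i, Vv i} \<and> m = i) \<or> (\<exists>i j. e = {Uv i, Xv i j} \<and> m = ux i j) \<or>
        (\<exists>i j. e = {Vv i, Xv i j} \<and> m = vx i j)" if "Gamma_label_rel n k e m" for m
    using that
  proof cases
    case uv then show ?thesis by blast
  next
    case (vx1 i)
    then have "e = {Vv i, Xv i 1} \<and> m = vx i 1" by (simp add: vx_def)
    then show ?thesis by blast
  next
    case (ux_last i)
    then have "e = {Uv i, Xv i (2*n+1)} \<and> m = ux i (2*n+1)" by (simp add: ux_def)
    then show ?thesis by blast
  next
    case (ux_odd i t)
    have "2*n-2*t+1 \<noteq> 2*n+1" "odd (2*n-2*t+1)" "(2*n+1-(2*n-2*t+1)) div 2 = t"
      using \<open>t \<in> {1..n}\<close> by auto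
    then have "ux i (2*n-2*t+1) = m" using ux_odd by (simp only: ux_def if_True if_False not_False_eq_True)
    with ux_odd have "e = {Uv i, Xv i (2*n-2*t+1)} \<and> m = ux i (2*n-2*t+1)" by (simp only: simp_thms)
    then show ?thesis by blast
  next
    case (ux_even i t)
    have "2*n-2*t+2 \<noteq> 2*n+1" "even (2*n-2*t+2)" "(2*n+2-(2*n-2*t+2)) div 2 = t"
      using \<open>t \<in> {1..n}\<close> by (presburger | auto)+
    then have "ux i (2*n-2*t+2) = m"
      using ux_even by (simp only: ux_def if_True if_False not_True_eq_False)
    with ux_even have "e = {Uv i, Xv i (2*n-2*t+2)} \<and> m = ux i (2*n-2*t+2)" by (simp only: simp_thms)
    then show ?thesis by blast
  next
    case (vx_even i t)
    have "2*t \<noteq> 1" by presburger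
    then have "vx i (2*t) = m" using vx_even by (simp add: vx_def)
    with vx_even have "e = {Vv i, Xv i (2*t)} \<and> m = vx i (2*t)" by (simp only: simp_thms)
    then show ?thesis by blast
  next
    case (vx_odd i t)
    then have "vx i (2*t+1) = m" by (simp add: vx_def)
    with vx_odd have "e = {Vv i, Xv i (2*t+1)} \<and> m = vx i (2*t+1)" by (simp only: simp_thms)
    then show ?thesis by blast
  qed
  from *[OF assms(1)] *[OF assms(2)] show ?thesis
    by (elim disjE exE conjE) (simp_all add: doubleton_eq_iff)
qed

lemma Gamma_label_rel_eq: "Gamma_label_rel n k e m \<Longrightarrow> Gamma_label n k e = m"
  unfolding Gamma_label_def using Gamma_label_rel_unique by blast

lemmas Gamma_label_eqs = Gamma_label_rel.intros[THEN Gamma_label_rel_eq]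

lemma Gamma_label_rel_edge:
  assumes "Gamma_label_rel n k e m"
  shows "e \<in> edges (Gamma n k)"
proof -
  have U: "{Uv i, Xv i j} \<in> edges (Gamma n k)" and V: "{Vv i, Xv i j} \<in> edges (Gamma n k)"
    if "i \<in> {1..2*k+1}" "j \<in> {1..2*n+1}" for i j
    using that unfolding Gamma_def by auto
  have W: "{Uv i, Vv i} \<in> edges (Gamma n k)" if "i \<in> {1..2*k+1}" for i
    using that unfolding Gamma_def by auto
  from assms show ?thesis
    by cases (auto intro!: U V W)
qed

lemma Gamma_label_rel_total:
  assumes "e \<in> edges (Gamma n k)"
  shows "\<exists>m. Gamma_label_rel n k e m"
proof -
  consider (uv) i where "i \<in> {1..2*k+1}" "e = {Uv i, Vv i}"
    | (ux) i j where "i \<in> {1..2*k+1}" "j \<in> {1..2*n+1}" "e = {Uv i, Xv i j}"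
    | (vx) i j where "i \<in> {1..2*k+1}" "j \<in> {1..2*n+1}" "e = {Vv i, Xv i j}"
    using assms unfolding Gamma_def by auto
  then show ?thesis
  proof cases
    case uv then show ?thesis by (blast intro: Gamma_label_rel.intros)
  next
    case (ux i j)
    have "j = 2*n+1 \<or> (\<exists>t\<in>{1..n}. j = 2*n-2*t+1) \<or> (\<exists>t\<in>{1..n}. j = 2*n-2*t+2)"
    proof (cases "odd j")
      case True
      then obtain c where "j = 2*c+1" by (elim oddE)
      then have "j = 2*n+1 \<or> (n-c \<in> {1..n} \<and> j = 2*n-2*(n-c)+1)" using ux by auto
      then show ?thesis by blast
    next
      case False
      then obtain c where "j = 2*c" by auto
      then have "n+1-c \<in> {1..n} \<and> j = 2*n-2*(n+1-c)+2" using ux by auto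
      then show ?thesis by blast
    qed
    then show ?thesis using ux Gamma_label_rel.intros(3-5)[of i k] by blast
  next
    case (vx i j)
    have "j = 1 \<or> (\<exists>t\<in>{1..n}. j = 2*t) \<or> (\<exists>t\<in>{1..n}. j = 2*t+1)"
    proof (cases "odd j")
      case True
      then obtain c where "j = 2*c+1" by (elim oddE)
      then have "j = 1 \<or> (c \<in> {1..n} \<and> j = 2*c+1)" using vx by auto
      then show ?thesis by blast
    next
      case False
      then obtain c where "j = 2*c" by auto
      then have "c \<in> {1..n} \<and> j = 2*c" using vx by auto
      then show ?thesis by blast
    qed
    then show ?thesis using vx Gamma_label_rel.intros(2,6,7)[of i k] by blast
  qed
qed

lemma Gamma_label_rel_range:
  assumes "Gamma_label_rel n k e m"
  shows "m \<in> {1..(2*k+1)*(4*n+3)}"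
proof -
  have *: "q * (2*k+1) + i \<in> {1..(2*k+1)*(4*n+3)}"
    if "i \<in> {1..2*k+1}" "q \<le> 4*n+2" for q i :: nat
  proof -
    have "q * (2*k+1) \<le> (4*n+2) * (2*k+1)" using that(2) by (rule mult_le_mono1)
    then show ?thesis using that by (simp add: algebra_simps)
  qed
  from assms show ?thesis
  proof cases
    case uv then show ?thesis using *[of m 0] by simp
  next
    case (vx1 i)
    then have h: "2*k+2-i \<in> {1..2*k+1}" "1 \<le> 4*n+2" "m = (1) * (2*k+1) + (2*k+2-i)"
      by (auto simp: algebra_simps)
    show ?thesis unfolding h(3) by (rule *[OF h(1,2)])
  next
    case (ux_last i)
    then have h: "2*k+2-i \<in> {1..2*k+1}" "2*(n+1) \<le> 4*n+2" "m = (2*(n+1)) * (2*k+1) + (2*k+2-i)"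
      by (auto simp: algebra_simps)
    show ?thesis unfolding h(3) by (rule *[OF h(1,2)])
  next
    case (ux_odd i t)
    then have h: "2*k+2-i \<in> {1..2*k+1}" "2*(n+t)+2 \<le> 4*n+2" "m = (2*(n+t)+2) * (2*k+1) + (2*k+2-i)"
      by (auto simp: algebra_simps)
    show ?thesis unfolding h(3) by (rule *[OF h(1,2)])
  next
    case (ux_even i t)
    then have h: "i \<in> {1..2*k+1}" "2*(n+t)+1 \<le> 4*n+2" "m = (2*(n+t)+1) * (2*k+1) + (i)"
      by (auto simp: algebra_simps)
    show ?thesis unfolding h(3) by (rule *[OF h(1,2)])
  next
    case (vx_even i t)
    then have h: "2*k+2-i \<in> {1..2*k+1}" "2*t \<le> 4*n+2" "m = (2*t) * (2*k+1) + (2*k+2-i)"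
      by (auto simp: algebra_simps)
    show ?thesis unfolding h(3) by (rule *[OF h(1,2)])
  next
    case (vx_odd i t)
    then have h: "i \<in> {1..2*k+1}" "2*t+1 \<le> 4*n+2" "m = (2*t+1) * (2*k+1) + (i)"
      by (auto simp: algebra_simps)
    show ?thesis unfolding h(3) by (rule *[OF h(1,2)])
  qed
qed

text \<open>Writing \<open>m - 1 = q (2k+1) + i'\<close> with \<open>i' \<le> 2k\<close>, the quotient \<open>q\<close> determines which clause
  produced the label \<open>m\<close> and \<open>i'\<close> determines \<open>i\<close>.\<close>

lemma Gamma_label_rel_surj:
  assumes "m \<in> {1..(2*k+1)*(4*n+3)}"
  shows "\<exists>e. Gamma_label_rel n k e m"
proof -
  define q where "q = (m - 1) div (2*k+1)"
  define i where "i = (m - 1) mod (2*k+1) + 1"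
  have m: "m = q * (2*k+1) + i"
    using assms div_mult_mod_eq[of "m - 1" "2*k+1"] unfolding q_def i_def by fastforce
  have i: "i \<in> {1..2*k+1}" by (simp add: i_def Suc_leI)
  have i': "2*k+2-i \<in> {1..2*k+1}" using i by auto
  have "m - 1 < (4*n+3) * (2*k+1)" using assms by (auto simp: algebra_simps)
  then have q: "q < 4*n+3" unfolding q_def by (simp add: less_mult_imp_div_less)
  note I = Gamma_label_rel.intros
  show ?thesis
  proof (cases "even q")
    case True
    then obtain c where c: "q = 2*c" by auto
    consider "c = 0" | "c \<in> {1..n}" | "c = n+1" | "c - n - 1 \<in> {1..n}" "c > n + 1"
      using q c by fastforce
    then show ?thesis
    proof cases
      case 1 then show ?thesis using I(1)[OF i] m c by auto
    next
      case 2 then show ?thesis using I(6)[OF i' 2] m c i by (auto simp: algebra_simps)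
    next
      case 3 then show ?thesis using I(3)[OF i', of n] m c i by (auto simp: algebra_simps)
    next
      case 4
      define t where "t = c - n - 1"
      have ct: "c = n + t + 1" using 4 t_def by simp
      have "6*k+4-(2*k+2-i) + (n+t)*(4*k+2) = m"
        using m c i ct by (auto simp: algebra_simps)
      then show ?thesis using I(4)[OF i', of t n] 4 t_def by metis
    qed
  next
    case False
    then obtain c where c: "q = 2*c+1" by (elim oddE)
    consider "c = 0" | "c \<in> {1..n}" | "c - n \<in> {1..n}" "c > n"
      using q c by fastforce
    then show ?thesis
    proof cases
      case 1
      have "4*k+3-(2*k+2-i) = m" using m c i 1 by auto
      then show ?thesis using I(2)[OF i'] by metis
    next
      case 2 then show ?thesis using I(7)[OF i 2] m c by (auto simp: algebra_simps)
    next
      case 3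
      define t where "t = c - n"
      have ct: "c = n + t" using 3 t_def by simp
      have "2*k+1+i + (n+t)*(4*k+2) = m"
        using m c i ct by (auto simp: algebra_simps)
      then show ?thesis using I(5)[OF i, of t n] 3 t_def by metis
    qed
  qed
qed

lemma bij_betw_Gamma_label:
  "bij_betw (Gamma_label n k) (edges (Gamma n k)) {1..(2*k+1)*(4*n+3)}"
proof -
  let ?E = "edges (Gamma n k)" and ?I = "{1..2*k+1}" and ?J = "{1..2*n+1}"
  let ?A = "(\<lambda>i. {Uv i, Vv i}) ` ?I" and ?B = "(\<lambda>(i, j). {Uv i, Xv i j}) ` (?I \<times> ?J)"
    and ?C = "(\<lambda>(i, j). {Vv i, Xv i j}) ` (?I \<times> ?J)"
  have E: "?E = ?A \<union> ?B \<union> ?C"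
    unfolding Gamma_def by (simp add: set_eq_iff image_iff Bex_def) blast
  have fin: "finite ?E" unfolding E by blast
  have "card ?A \<le> 2*k+1" using card_image_le[of ?I "\<lambda>i. {Uv i, Vv i}"] by simp
  moreover have "card ?B \<le> (2*k+1)*(2*n+1)"
    using card_image_le[of "?I \<times> ?J" "\<lambda>(i, j). {Uv i, Xv i j}"] by (simp add: card_cartesian_product)
  moreover have "card ?C \<le> (2*k+1)*(2*n+1)"
    using card_image_le[of "?I \<times> ?J" "\<lambda>(i, j). {Vv i, Xv i j}"] by (simp add: card_cartesian_product)
  moreover have "card ?E \<le> card ?A + card ?B + card ?C"
    unfolding E using card_Un_le[of "?A \<union> ?B" ?C] card_Un_le[of ?A ?B] by linarith
  ultimately have "card ?E \<le> (2*k+1) + (2*k+1)*(2*n+1) + (2*k+1)*(2*n+1)" by linarith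
  also have "\<dots> = (2*k+1)*(4*n+3)" by (simp add: algebra_simps)
  finally have le: "card ?E \<le> (2*k+1)*(4*n+3)" .
  have im: "Gamma_label n k ` ?E = {1..(2*k+1)*(4*n+3)}"
  proof
    show "Gamma_label n k ` ?E \<subseteq> {1..(2*k+1)*(4*n+3)}"
      using Gamma_label_rel_total Gamma_label_rel_eq Gamma_label_rel_range by fast
    show "{1..(2*k+1)*(4*n+3)} \<subseteq> Gamma_label n k ` ?E"
    proof
      fix m assume "m \<in> {1..(2*k+1)*(4*n+3)}"
      then obtain e where e: "Gamma_label_rel n k e m" using Gamma_label_rel_surj by blast
      show "m \<in> Gamma_label n k ` ?E"
        using Gamma_label_rel_eq[OF e] Gamma_label_rel_edge[OF e] by blast
    qed
  qed
  have "card (Gamma_label n k ` ?E) = card ?E"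
    using le im card_image_le[OF fin, of "Gamma_label n k"] by simp
  then have "inj_on (Gamma_label n k) ?E" by (rule eq_card_imp_inj_on[OF fin])
  with im show ?thesis by (simp add: bij_betw_def)
qed

definition Gamma_sigma :: "nat \<Rightarrow> nat \<Rightarrow> nat \<Rightarrow> nat \<Rightarrow> nat" where
  "Gamma_sigma n k j i = Gamma_label n k {Uv i, Xv i j} + Gamma_label n k {Vv i, Xv i j}"

definition admissible_partition ::
    "nat \<Rightarrow> nat \<Rightarrow> nat \<Rightarrow> nat \<Rightarrow> nat \<Rightarrow> nat set set \<Rightarrow> bool" where
  "admissible_partition n k r s j P \<longleftrightarrow>
     partition_on {1..2*k+1} P \<and> card P = 2*r+1 \<and>
     (\<forall>B\<in>P. card B = 2*s+1 \<and>
        (\<Sum>i\<in>B. Gamma_sigma n k j i) = (2*s+1) * ((8*k+5) + 2*n*(4*k+2)))"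

text \<open>Identification of vertices along an equivalence relation on the vertex set: the new vertices
  are the equivalence classes.\<close>

definition quotient_graph :: "'a ugraph \<Rightarrow> ('a \<times> 'a) set \<Rightarrow> 'a set ugraph" where
  "quotient_graph G R =
     \<lparr> verts = verts G // R, edges = (\<lambda>e. (\<lambda>a. R `` {a}) ` e) ` edges G \<rparr>"

definition merge_rel :: "nat \<Rightarrow> nat \<Rightarrow> (nat \<Rightarrow> nat set set) \<Rightarrow> (gvertex \<times> gvertex) set" where
  "merge_rel n k P =
     Id_on (verts (Gamma n k)) \<union>
     {(Xv i j, Xv i' j) | i i' j. j \<in> {1..2*n+1} \<and> (\<exists>B\<in>P j. i \<in> B \<and> i' \<in> B)}"

lemma equiv_merge_rel:
  assumes "\<And>j. j \<in> {1..2*n+1} \<Longrightarrow> partition_on {1..2*k+1} (P j)"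
  shows "equiv (verts (Gamma n k)) (merge_rel n k P)"
proof (rule equivI)
  have sub: "i \<in> {1..2*k+1}" if "j \<in> {1..2*n+1}" "B \<in> P j" "i \<in> B" for i j B
    using partition_onD1[OF assms[OF that(1)]] that(2,3) by blast
  have eq: "B = B'" if "j \<in> {1..2*n+1}" "B \<in> P j" "B' \<in> P j" "i \<in> B" "i \<in> B'" for i j B B'
    using partition_onD2[OF assms[OF that(1)]] that(2-) by (auto simp: disjoint_def)
  have X: "Xv i j \<in> verts (Gamma n k)" if "i \<in> {1..2*k+1}" "j \<in> {1..2*n+1}" for i j
    using that unfolding Gamma_def by auto
  show "merge_rel n k P \<subseteq> verts (Gamma n k) \<times> verts (Gamma n k)"
    unfolding merge_rel_def using X sub by blast
  show "refl_on (verts (Gamma n k)) (merge_rel n k P)"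
    unfolding merge_rel_def refl_on_def by blast
  show "sym (merge_rel n k P)"
    unfolding merge_rel_def sym_def by blast
  show "trans (merge_rel n k P)"
  proof (rule transI)
    fix a b c assume ab: "(a, b) \<in> merge_rel n k P" and bc: "(b, c) \<in> merge_rel n k P"
    show "(a, c) \<in> merge_rel n k P"
    proof (cases "a = b \<or> b = c")
      case True then show ?thesis using ab bc by blast
    next
      case False
      obtain i i' j B where 1: "a = Xv i j" "b = Xv i' j" "j \<in> {1..2*n+1}" "B \<in> P j" "i \<in> B" "i' \<in> B"
        using ab False unfolding merge_rel_def by blast
      obtain l B' where 2: "c = Xv l j" "B' \<in> P j" "i' \<in> B'" "l \<in> B'"
        using bc False 1(2) unfolding merge_rel_def by blast
      have "B = B'" using eq 1 2 by blast
      then show ?thesis using 1 2 unfolding merge_rel_def by blast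
    qed
  qed
qed

text \<open>The class \<open>\<G>\<^bsub>2n+1\<^esub>(2r+1, 2s+1)\<close>, closed under isomorphism so that the vertices may be of
  any type. The parameter \<open>k\<close> is meant to satisfy \<open>2k + 1 = (2r + 1)(2s + 1)\<close>.\<close>

definition graph_class :: "nat \<Rightarrow> nat \<Rightarrow> nat \<Rightarrow> nat \<Rightarrow> 'a ugraph set" where
  "graph_class n k r s =
     {G. \<exists>P. (\<forall>j\<in>{1..2*n+1}. admissible_partition n k r s j (P j)) \<and>
             graph_iso (quotient_graph (Gamma n k) (merge_rel n k P)) G}"

end

theory Submission
  imports Defs
begin

text \<open>
  The labeling of \<open>\<Gamma>\<close> has constant vertex sums \<open>a\<close> on the \<open>u\<^sub>i\<close> and \<open>b\<close> on the \<open>v\<^sub>i\<close>. The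
  identifications merge no edges, so the labeling descends to \<open>G\<close>, where the sum at a vertex is
  the total of the sums over its fibre; admissibility makes it a constant \<open>c\<close> on the merged
  vertices. With \<open>N = n + 1\<close>, \<open>S = 2s + 1\<close>, \<open>R = 2r + 1\<close> and \<open>E = 2RS\<close> one has
  \<open>a = E (3N\<^sup>2 - 2N + 1/2) + N\<close>, \<open>b = E N\<^sup>2 + N\<close> and \<open>c = 2SNE + S\<close>, which are pairwise different
  since \<open>R \<ge> 3\<close>. Conversely, the triangle on \<open>u\<^sub>1\<close>, \<open>v\<^sub>1\<close> and the image of \<open>x\<^sub>1\<^sub>1\<close> forces three values.
\<close>

section \<open>Pushing a labeling forward along a vertex map\<close>

text \<open>The choice made by \<open>inv_into\<close> is forced as long as \<open>p\<close> merges
  no two edges of \<open>H\<close>, which both lemmas below assume.\<close>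

definition push_label :: "'a ugraph \<Rightarrow> ('a \<Rightarrow> 'b) \<Rightarrow> ('a set \<Rightarrow> nat) \<Rightarrow> 'b set \<Rightarrow> nat" where
  "push_label H p f = f \<circ> inv_into (edges H) ((`) p)"

lemma bij_betw_push_label:
  assumes "edges G = (`) p ` edges H" and "inj_on ((`) p) (edges H)"
    and "bij_betw f (edges H) A"
  shows "bij_betw (push_label H p f) (edges G) A"
  unfolding push_label_def
  by (rule bij_betw_trans[OF bij_betw_inv_into assms(3)])
    (use assms(1,2) in \<open>simp add: bij_betw_def\<close>)

text \<open>The edges at \<open>w\<close> are the images of the edges of \<open>H\<close> that meet
  the fibre of \<open>w\<close>. Since \<open>p\<close> is injective on each edge, such an edge
  meets the fibre in exactly one vertex, so the stars of the fibre vertices are disjoint and their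
  sums add up.\<close>

lemma vertex_sum_push_label:
  assumes G: "edges G = (`) p ` edges H" and inj: "inj_on ((`) p) (edges H)"
    and fin: "finite (edges H)" "finite (verts H)"
    and sub: "\<And>e. e \<in> edges H \<Longrightarrow> e \<subseteq> verts H"
    and inj_e: "\<And>e. e \<in> edges H \<Longrightarrow> inj_on p e"
  shows "vertex_sum G (push_label H p f) w = (\<Sum>a\<in>{a \<in> verts H. p a = w}. vertex_sum H f a)"
proof -
  let ?F = "{a \<in> verts H. p a = w}"
  have "{e \<in> edges G. w \<in> e} = (`) p ` {e \<in> edges H. w \<in> p ` e}"
    unfolding G by blast
  then have "vertex_sum G (push_label H p f) w
      = (\<Sum>e\<in>{e \<in> edges H. w \<in> p ` e}. push_label H p f (p ` e))"
    unfolding vertex_sum_def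
    by (simp add: sum.reindex inj_on_subset[OF inj])
  also have "\<dots> = (\<Sum>e\<in>{e \<in> edges H. w \<in> p ` e}. f e)"
    by (rule sum.cong) (auto simp: push_label_def inv_into_f_f[OF inj])
  also have "{e \<in> edges H. w \<in> p ` e} = (\<Union>a\<in>?F. {e \<in> edges H. a \<in> e})"
    using sub by blast
  also have "(\<Sum>e\<in>\<dots>. f e) = (\<Sum>a\<in>?F. vertex_sum H f a)"
    unfolding vertex_sum_def
    by (rule sum.UNION_disjoint) (use fin inj_e in \<open>auto dest: inj_onD\<close>)
  finally show ?thesis .
qed

text \<open>The corners are pairwise adjacent, so every local antimagic labeling gives them distinct
  sums. If there is no such labeling, the infimum is infinite and the bound still holds.\<close>

lemma three_le_chi_la_if_triangle:
  assumes "finite (verts G)" and "x \<in> verts G" "y \<in> verts G" "z \<in> verts G"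
    and "{x, y} \<in> edges G" "{x, z} \<in> edges G" "{y, z} \<in> edges G"
  shows "3 \<le> chi_la G"
  unfolding chi_la_def
proof (rule INF_greatest)
  fix f assume "f \<in> {f. local_antimagic G f}"
  then have "card {vertex_sum G f x, vertex_sum G f y, vertex_sum G f z} = 3"
    using assms(5-7) unfolding local_antimagic_def by auto
  moreover have "{vertex_sum G f x, vertex_sum G f y, vertex_sum G f z} \<subseteq> vertex_sum G f ` verts G"
    using assms(2-4) by blast
  ultimately have "3 \<le> card (vertex_sum G f ` verts G)"
    using card_mono[of "vertex_sum G f ` verts G"] assms(1) by (metis finite_imageI)
  then have "enat 3 \<le> enat (card (vertex_sum G f ` verts G))" by simp
  then show "3 \<le> enat (card (vertex_sum G f ` verts G))" by (simp add: numeral_eq_enat)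
qed

section \<open>Vertex sums in the graph \<open>\<Gamma>\<close>\<close>

lemma verts_Gamma_iff [simp]:
  "Uv i \<in> verts (Gamma n k) \<longleftrightarrow> i \<in> {1..2*k+1}"
  "Vv i \<in> verts (Gamma n k) \<longleftrightarrow> i \<in> {1..2*k+1}"
  "Xv i j \<in> verts (Gamma n k) \<longleftrightarrow> i \<in> {1..2*k+1} \<and> j \<in> {1..2*n+1}"
  unfolding Gamma_def by auto

lemma edges_Gamma_cases:
  assumes "e \<in> edges (Gamma n k)"
  obtains (uv) i where "i \<in> {1..2*k+1}" "e = {Uv i, Vv i}"
    | (ux) i j where "i \<in> {1..2*k+1}" "j \<in> {1..2*n+1}" "e = {Uv i, Xv i j}"
    | (vx) i j where "i \<in> {1..2*k+1}" "j \<in> {1..2*n+1}" "e = {Vv i, Xv i j}"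
  using assms unfolding Gamma_def by auto

lemma edges_GammaI:
  assumes "i \<in> {1..2*k+1}"
  shows "{Uv i, Vv i} \<in> edges (Gamma n k)"
    and "j \<in> {1..2*n+1} \<Longrightarrow> {Uv i, Xv i j} \<in> edges (Gamma n k)"
    and "j \<in> {1..2*n+1} \<Longrightarrow> {Vv i, Xv i j} \<in> edges (Gamma n k)"
  using assms unfolding Gamma_def by auto

lemma finite_verts_Gamma: "finite (verts (Gamma n k))"
proof -
  have "verts (Gamma n k) \<subseteq> Uv ` {1..2*k+1} \<union> Vv ` {1..2*k+1}
      \<union> (\<lambda>(i, j). Xv i j) ` ({1..2*k+1} \<times> {1..2*n+1})"
    unfolding Gamma_def by auto
  then show ?thesis by (rule finite_subset) blast
qed

lemma finite_edges_Gamma: "finite (edges (Gamma n k))"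
  using bij_betw_finite[OF bij_betw_Gamma_label[of n k]] by simp

lemma edge_Gamma_subset_verts: "e \<in> edges (Gamma n k) \<Longrightarrow> e \<subseteq> verts (Gamma n k)"
  by (erule edges_Gamma_cases) auto

lemma vertex_sum_Gamma_Uv:
  assumes "i \<in> {1..2*k+1}"
  shows "vertex_sum (Gamma n k) f (Uv i) = f {Uv i, Vv i} + (\<Sum>j=1..2*n+1. f {Uv i, Xv i j})"
proof -
  have "{e \<in> edges (Gamma n k). Uv i \<in> e}
      = insert {Uv i, Vv i} ((\<lambda>j. {Uv i, Xv i j}) ` {1..2*n+1})"
    using assms by (auto elim!: edges_Gamma_cases intro: edges_GammaI)
  moreover have "inj_on (\<lambda>j. {Uv i, Xv i j}) A" for A
    by (auto simp: inj_on_def doubleton_eq_iff)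
  moreover have "{Uv i, Vv i} \<notin> (\<lambda>j. {Uv i, Xv i j}) ` {1..2*n+1}"
    by (auto simp: doubleton_eq_iff)
  ultimately show ?thesis
    unfolding vertex_sum_def by (simp add: sum.reindex del: sum.cl_ivl_Suc)
qed

lemma vertex_sum_Gamma_Vv:
  assumes "i \<in> {1..2*k+1}"
  shows "vertex_sum (Gamma n k) f (Vv i) = f {Uv i, Vv i} + (\<Sum>j=1..2*n+1. f {Vv i, Xv i j})"
proof -
  have "{e \<in> edges (Gamma n k). Vv i \<in> e}
      = insert {Uv i, Vv i} ((\<lambda>j. {Vv i, Xv i j}) ` {1..2*n+1})"
    using assms by (auto elim!: edges_Gamma_cases intro: edges_GammaI)
  moreover have "inj_on (\<lambda>j. {Vv i, Xv i j}) A" for A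
    by (auto simp: inj_on_def doubleton_eq_iff)
  moreover have "{Uv i, Vv i} \<notin> (\<lambda>j. {Vv i, Xv i j}) ` {1..2*n+1}"
    by (auto simp: doubleton_eq_iff)
  ultimately show ?thesis
    unfolding vertex_sum_def by (simp add: sum.reindex del: sum.cl_ivl_Suc)
qed

lemma vertex_sum_Gamma_Xv:
  assumes "i \<in> {1..2*k+1}" "j \<in> {1..2*n+1}"
  shows "vertex_sum (Gamma n k) f (Xv i j) = f {Uv i, Xv i j} + f {Vv i, Xv i j}"
proof -
  have "{e \<in> edges (Gamma n k). Xv i j \<in> e} = {{Uv i, Xv i j}, {Vv i, Xv i j}}"
    using assms by (auto elim!: edges_Gamma_cases intro: edges_GammaI)
  moreover have "{Uv i, Xv i j} \<noteq> {Vv i, Xv i j}" by (auto simp: doubleton_eq_iff)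
  ultimately show ?thesis unfolding vertex_sum_def by simp
qed

text \<open>Groups the indices as the label clauses at \<open>Vv i\<close> do, so that
  \<open>i\<close> cancels within each pair.\<close>

lemma sum_pairs_from_first:
  "(\<Sum>j=1..2*n+1. g j) = g 1 + (\<Sum>t=1..n. g (2*t) + g (2*t+1))"
  for g :: "nat \<Rightarrow> nat"
  by (induction n) (auto simp: algebra_simps)

text \<open>The grouping of the clauses at \<open>Uv i\<close>, obtained from the previous one by
  reflecting \<open>j\<close> to \<open>2*n+2-j\<close>.\<close>

lemma sum_pairs_from_last:
  "(\<Sum>j=1..2*n+1. g j) = g (2*n+1) + (\<Sum>t=1..n. g (2*n-2*t+1) + g (2*n-2*t+2))"
  for g :: "nat \<Rightarrow> nat"
proof -
  have "(\<Sum>j=1..2*n+1. g j) = (\<Sum>j=1..2*n+1. g (2*n+2-j))"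
    by (rule sum.reindex_bij_witness[of _ "\<lambda>j. 2*n+2-j" "\<lambda>j. 2*n+2-j"]) auto
  also have "\<dots> = g (2*n+1) + (\<Sum>t=1..n. g (2*n+2-2*t) + g (2*n+2-(2*t+1)))"
    unfolding sum_pairs_from_first by simp
  also have "(\<Sum>t=1..n. g (2*n+2-2*t) + g (2*n+2-(2*t+1)))
      = (\<Sum>t=1..n. g (2*n-2*t+1) + g (2*n-2*t+2))"
  proof (rule sum.cong)
    fix t assume "t \<in> {1..n}"
    then have "2*n+2-2*t = 2*n-2*t+2" "2*n+2-(2*t+1) = 2*n-2*t+1" by auto
    then show "g (2*n+2-2*t) + g (2*n+2-(2*t+1)) = g (2*n-2*t+1) + g (2*n-2*t+2)" by simp
  qed simp
  finally show ?thesis .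
qed

text \<open>The offset \<open>m\<close> serves both sides: \<open>m = n\<close> for the edges at
  \<open>Uv i\<close>, \<open>m = 0\<close> for those at \<open>Vv i\<close>.\<close>

lemma sum_arith_progression:
  "(\<Sum>t=1..n. c + 2*(m+t)*E) = n*c + (2*m*n + n*(n+1))*E" for c m E :: nat
  by (induction n) (auto simp: algebra_simps)

text \<open>The index \<open>i\<close> enters with opposite signs in the two labels of each pair,
  and likewise in the labels of \<open>{Uv i, Vv i}\<close> and
  \<open>{Uv i, Xv i (2*n+1)}\<close>.\<close>

lemma vertex_sum_Gamma_label_Uv:
  assumes i: "i \<in> {1..2*k+1}"
  shows "vertex_sum (Gamma n k) (Gamma_label n k) (Uv i)
    = 2*k+2 + n*(8*k+5) + (3*n*n + 2*n + 1)*(4*k+2)"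
proof -
  have "(\<Sum>t=1..n. Gamma_label n k {Uv i, Xv i (2*n-2*t+1)} + Gamma_label n k {Uv i, Xv i (2*n-2*t+2)})
      = (\<Sum>t=1..n. (8*k+5) + 2*(n+t)*(4*k+2))"
  proof (rule sum.cong)
    fix t assume t: "t \<in> {1..n}"
    show "Gamma_label n k {Uv i, Xv i (2*n-2*t+1)} + Gamma_label n k {Uv i, Xv i (2*n-2*t+2)}
        = (8*k+5) + 2*(n+t)*(4*k+2)"
      unfolding Gamma_label_eqs(4,5)[OF i t] using i by (auto simp: algebra_simps)
  qed simp
  then show ?thesis
    unfolding vertex_sum_Gamma_Uv[OF i] sum_pairs_from_last sum_arith_progression
      Gamma_label_eqs(1)[OF i] Gamma_label_eqs(3)[OF i]
    using i by (auto simp: algebra_simps)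
qed

text \<open>Here the label \<open>i\<close> of \<open>{Uv i, Vv i}\<close> cancels against
  \<open>4*k+3-i\<close> on \<open>{Vv i, Xv i 1}\<close>.\<close>

lemma vertex_sum_Gamma_label_Vv:
  assumes i: "i \<in> {1..2*k+1}"
  shows "vertex_sum (Gamma n k) (Gamma_label n k) (Vv i)
    = (n+1)*(4*k+3) + n*(n+1)*(4*k+2)"
proof -
  have "(\<Sum>t=1..n. Gamma_label n k {Vv i, Xv i (2*t)} + Gamma_label n k {Vv i, Xv i (2*t+1)})
      = (\<Sum>t=1..n. (4*k+3) + 2*(0+t)*(4*k+2))"
  proof (rule sum.cong)
    fix t assume t: "t \<in> {1..n}"
    show "Gamma_label n k {Vv i, Xv i (2*t)} + Gamma_label n k {Vv i, Xv i (2*t+1)}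
        = (4*k+3) + 2*(0+t)*(4*k+2)"
      unfolding Gamma_label_eqs(6,7)[OF i t] using i by (auto simp: algebra_simps)
  qed simp
  then show ?thesis
    unfolding vertex_sum_Gamma_Vv[OF i] sum_pairs_from_first sum_arith_progression
      Gamma_label_eqs(1)[OF i] Gamma_label_eqs(2)[OF i]
    using i by (auto simp: algebra_simps)
qed

section \<open>The three sums are pairwise different\<close>

text \<open>Each assumed equality says that \<open>H\<close> times an integer factor is 0 or
  \<open>N - S\<close>. The possible signs of the factor are excluded one by one, with
  \<open>H \<ge> 3*S\<close>, a consequence of \<open>r \<ge> 1\<close>, as the size
  estimate.\<close>

lemma sums_neq:
  fixes n r s k :: nat
  assumes r: "r \<ge> 1" and k: "k = 2*r*s + r + s"
  defines "a \<equiv> 2*k+2 + n*(8*k+5) + (3*n*n + 2*n + 1)*(4*k+2)"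
    and "b \<equiv> (n+1)*(4*k+3) + n*(n+1)*(4*k+2)"
    and "c \<equiv> (2*s+1) * ((8*k+5) + 2*n*(4*k+2))"
  shows "a \<noteq> b" and "a \<noteq> c" and "b \<noteq> c"
proof -
  define N S H :: int where "N = int n + 1" and "S = 2 * int s + 1" and "H = 2 * int k + 1"
  have N: "N \<ge> 1" and S: "S \<ge> 1" by (auto simp: N_def S_def)
  have "H = (2 * int r + 1) * S" unfolding H_def S_def k by (simp add: algebra_simps)
  moreover have "3 * S \<le> (2 * int r + 1) * S" using r S by (intro mult_right_mono) auto
  ultimately have H: "H \<ge> 3 * S" by simp
  have a: "int a = H * (6*N*N - 4*N + 1) + N"
    unfolding a_def N_def H_def by (simp add: algebra_simps)
  have b: "int b = 2*H*N*N + N"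
    unfolding b_def N_def H_def by (simp add: algebra_simps)
  have c: "int c = 4*S*N*H + S"
    unfolding c_def N_def H_def S_def by (simp add: algebra_simps)
  show "a \<noteq> b"
  proof
    assume "a = b"
    then have "H * (4*N*(N-1) + 1) = 0" using a b by (simp add: algebra_simps)
    moreover have "4*N*(N-1) \<ge> 0" using N by simp
    ultimately show False using H S by simp
  qed
  show "a \<noteq> c"
  proof
    assume "a = c"
    then have eq: "H * (4*S*N + 4*N - 6*N*N - 1) = N - S" using a c by (simp add: algebra_simps)
    define m where "m = 4*S*N + 4*N - 6*N*N - 1"
    \<comment> \<open>All terms but the last are even; parity rules out
      \<open>m = 0\<close>.\<close>
    have "odd m" by (simp add: m_def)
    then have "m \<le> -1 \<or> m \<ge> 1" by (cases "m = 0") auto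
    then show False
    proof
      assume "m \<le> -1"
      \<comment> \<open>The left side of \<open>eq\<close> is at most \<open>-3*S\<close>, while
        \<open>N - S \<ge> 1 - S\<close>.\<close>
      then have "H * m \<le> H * (-1)" using H S by (intro mult_left_mono) auto
      then show False using eq H S N unfolding m_def[symmetric] by simp
    next
      assume m: "m \<ge> 1"
      then have "H * 1 \<le> H * m" using H S by (intro mult_left_mono) auto
      \<comment> \<open>\<open>N - S \<ge> H \<ge> 3*S\<close> gives this bound, and then the
        quadratic term \<open>-6*N*N\<close> makes \<open>m\<close> negative.\<close>
      then have "N \<ge> 4 * S" using eq H unfolding m_def[symmetric] by simp
      then have "N * (4*S + 4 - 6*N) \<le> 0" using N S by (intro mult_nonneg_nonpos) auto
      then show False using m unfolding m_def by (simp add: algebra_simps)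
    qed
  qed
  show "b \<noteq> c"
  proof
    assume "b = c"
    then have eq: "2*H*N*(2*S - N) = N - S" using b c by (simp add: algebra_simps)
    have HN: "2*H*N \<ge> 2*H" "2*H*N \<ge> 2*N" using N H S
      by (simp_all add: mult_le_cancel_left1 mult_le_cancel_right1)
    \<comment> \<open>Unless \<open>2*S = N\<close>, the left side of \<open>eq\<close> has absolute
      value at least \<open>2*H*N\<close>, which exceeds that of \<open>N - S\<close>.\<close>
    consider "2*S - N \<ge> 1" | "2*S = N" | "2*S - N \<le> -1" by linarith
    then show False
    proof cases
      case 1
      then have "2*H*N * 1 \<le> 2*H*N*(2*S - N)" using HN N by (intro mult_left_mono) auto
      then show False using eq HN N S by simp
    next
      case 2
      then show False using eq S by simp
    next
      case 3
      then have "2*H*N*(2*S - N) \<le> 2*H*N * (-1)" using HN N by (intro mult_left_mono) auto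
      then show False using eq HN N S H by simp
    qed
  qed
qed

section \<open>The vertex map from \<open>\<Gamma>\<close> to a graph of the class\<close>

text \<open>Composes the projection onto classes with the isomorphism, so that the main proof works
  with vertices of \<open>Gamma n k\<close> and the kernel of \<open>p\<close> alone.\<close>

lemma graph_class_vertex_map:
  assumes "G \<in> graph_class n k r s"
  obtains P p where "\<And>j. j \<in> {1..2*n+1} \<Longrightarrow> admissible_partition n k r s j (P j)"
    and "verts G = p ` verts (Gamma n k)" and "edges G = (`) p ` edges (Gamma n k)"
    and "\<And>a b. a \<in> verts (Gamma n k) \<Longrightarrow> b \<in> verts (Gamma n k) \<Longrightarrow>
           p a = p b \<longleftrightarrow> (a, b) \<in> merge_rel n k P"
proof -
  obtain P \<phi> where P: "\<And>j. j \<in> {1..2*n+1} \<Longrightarrow> admissible_partition n k r s j (P j)"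
    and \<phi>: "bij_betw \<phi> (verts (Gamma n k) // merge_rel n k P) (verts G)"
    and E: "edges G = (`) \<phi> ` edges (quotient_graph (Gamma n k) (merge_rel n k P))"
    using assms unfolding graph_class_def graph_iso_def
    by (auto simp only: mem_Collect_eq quotient_graph_def ugraph.simps)
  let ?R = "merge_rel n k P"
  define p where "p a = \<phi> (?R `` {a})" for a
  have R: "equiv (verts (Gamma n k)) ?R"
    by (rule equiv_merge_rel) (use P in \<open>auto simp: admissible_partition_def\<close>)
  show thesis
  proof (rule that[OF P])
    have "verts G = \<phi> ` (verts (Gamma n k) // ?R)" using \<phi> by (simp add: bij_betw_def)
    then show "verts G = p ` verts (Gamma n k)" by (auto simp: p_def quotient_def)
    show "edges G = (`) p ` edges (Gamma n k)"
      unfolding E quotient_graph_def by (simp add: image_image p_def)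
    fix a b assume ab: "a \<in> verts (Gamma n k)" "b \<in> verts (Gamma n k)"
    then have "p a = p b \<longleftrightarrow> ?R `` {a} = ?R `` {b}"
      unfolding p_def using \<phi> by (auto simp: bij_betw_def inj_on_eq_iff quotientI)
    then show "p a = p b \<longleftrightarrow> (a, b) \<in> ?R"
      using eq_equiv_class_iff[OF R ab] by simp
  qed
qed

text \<open>The last clause is one-way because a common second index does not suffice for
  merging.\<close>

lemma merge_rel_simps:
  "(Uv i, b) \<in> merge_rel n k P \<longleftrightarrow> b = Uv i \<and> i \<in> {1..2*k+1}"
  "(Vv i, b) \<in> merge_rel n k P \<longleftrightarrow> b = Vv i \<and> i \<in> {1..2*k+1}"
  "(a, Uv i) \<in> merge_rel n k P \<longleftrightarrow> a = Uv i \<and> i \<in> {1..2*k+1}"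
  "(a, Vv i) \<in> merge_rel n k P \<longleftrightarrow> a = Vv i \<and> i \<in> {1..2*k+1}"
  "(Xv i j, Xv i' j') \<in> merge_rel n k P \<Longrightarrow> j = j'"
  unfolding merge_rel_def by auto

text \<open>Disjointness makes \<open>B\<close> the only block of \<open>P j\<close> containing
  \<open>i\<close>, so nothing outside \<open>B\<close> is merged with
  \<open>Xv i j\<close>.\<close>

lemma merge_rel_Xv_block:
  assumes "partition_on {1..2*k+1} (P j)" "j \<in> {1..2*n+1}" "B \<in> P j" "i \<in> B"
  shows "{a \<in> verts (Gamma n k). (a, Xv i j) \<in> merge_rel n k P} = (\<lambda>i'. Xv i' j) ` B"
proof -
  have sub: "B \<subseteq> {1..2*k+1}" using assms partition_onD1 by blast
  have uniq: "B' = B" if "B' \<in> P j" "i \<in> B'" for B'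
    using partition_onD2[OF assms(1)] that assms(3,4) by (auto simp: disjoint_def)
  have "(a, Xv i j) \<in> merge_rel n k P \<longleftrightarrow> a \<in> (\<lambda>i'. Xv i' j) ` B"
    if a: "a \<in> verts (Gamma n k)" for a
  proof
    assume "(a, Xv i j) \<in> merge_rel n k P"
    then consider "a = Xv i j" | i' B' where "a = Xv i' j" "B' \<in> P j" "i' \<in> B'" "i \<in> B'"
      unfolding merge_rel_def by blast
    then show "a \<in> (\<lambda>i'. Xv i' j) ` B"
      by cases (use uniq assms(4) in blast)+
  next
    assume "a \<in> (\<lambda>i'. Xv i' j) ` B"
    then show "(a, Xv i j) \<in> merge_rel n k P"
      using assms(2-4) unfolding merge_rel_def by blast
  qed
  moreover have "(\<lambda>i'. Xv i' j) ` B \<subseteq> verts (Gamma n k)"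
    using sub assms(2) by auto
  ultimately show ?thesis by blast
qed

theorem theorem3p2:
  fixes n r s k :: nat and G :: "'a ugraph"
  assumes "n \<ge> 1" and "r \<ge> 1" and "s \<ge> 1"
    and "k = 2*r*s + r + s"
    and "G \<in> graph_class n k r s"
  shows "chi_la G = 3"
proof -
  let ?H = "Gamma n k" and ?f = "Gamma_label n k"
  obtain P p where P: "\<And>j. j \<in> {1..2*n+1} \<Longrightarrow> admissible_partition n k r s j (P j)"
    and V: "verts G = p ` verts ?H" and E: "edges G = (`) p ` edges ?H"
    and p: "\<And>a b. a \<in> verts ?H \<Longrightarrow> b \<in> verts ?H \<Longrightarrow> p a = p b \<longleftrightarrow> (a, b) \<in> merge_rel n k P"
    using graph_class_vertex_map[OF assms(5)] by blast
  note p_simps = p merge_rel_simps(1-4)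
  \<comment> \<open>Every edge has an end \<open>Uv i\<close> or \<open>Vv i\<close>, which is
    merged with nothing and so determines \<open>i\<close>; the index \<open>j\<close> of an
    \<open>Xv\<close> end survives merging.\<close>
  have inj: "inj_on ((`) p) (edges ?H)"
  proof (rule inj_onI)
    fix e e' assume "e \<in> edges ?H" "e' \<in> edges ?H" "p ` e = p ` e'"
    then show "e = e'"
      by (elim edges_Gamma_cases) (auto simp: doubleton_eq_iff p_simps dest: merge_rel_simps(5))
  qed
  \<comment> \<open>The ends of an edge have different constructors, and such vertices are never
    merged.\<close>
  have inj_e: "inj_on p e" if "e \<in> edges ?H" for e
    using that by (cases rule: edges_Gamma_cases) (auto simp: p_simps)
  define g where "g = push_label ?H p ?f"
  have sum_g: "vertex_sum G g w = (\<Sum>x\<in>{x \<in> verts ?H. p x = w}. vertex_sum ?H ?f x)" for w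
    unfolding g_def using E inj finite_edges_Gamma finite_verts_Gamma
    by (rule vertex_sum_push_label) (use edge_Gamma_subset_verts inj_e in blast)+
  define a where "a = 2*k+2 + n*(8*k+5) + (3*n*n + 2*n + 1)*(4*k+2)"
  define b where "b = (n+1)*(4*k+3) + n*(n+1)*(4*k+2)"
  define c where "c = (2*s+1) * ((8*k+5) + 2*n*(4*k+2))"
  have U: "vertex_sum G g (p (Uv i)) = a" if "i \<in> {1..2*k+1}" for i
  proof -
    have "{x \<in> verts ?H. p x = p (Uv i)} = {Uv i}" using that by (auto simp: p_simps)
    then show ?thesis unfolding sum_g a_def using vertex_sum_Gamma_label_Uv[OF that] by simp
  qed
  have W: "vertex_sum G g (p (Vv i)) = b" if "i \<in> {1..2*k+1}" for i
  proof -
    have "{x \<in> verts ?H. p x = p (Vv i)} = {Vv i}" using that by (auto simp: p_simps)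
    then show ?thesis unfolding sum_g b_def using vertex_sum_Gamma_label_Vv[OF that] by simp
  qed
  have X: "vertex_sum G g (p (Xv i j)) = c" if ij: "i \<in> {1..2*k+1}" "j \<in> {1..2*n+1}" for i j
  proof -
    have part: "partition_on {1..2*k+1} (P j)"
      using P[OF ij(2)] by (simp add: admissible_partition_def)
    then obtain B where B: "B \<in> P j" "i \<in> B" using ij(1) partition_onD1 by blast
    have "{x \<in> verts ?H. p x = p (Xv i j)} = {x \<in> verts ?H. (x, Xv i j) \<in> merge_rel n k P}"
      using p ij by auto
    also have "\<dots> = (\<lambda>i'. Xv i' j) ` B"
      using part ij(2) B by (rule merge_rel_Xv_block)
    finally have "vertex_sum G g (p (Xv i j)) = (\<Sum>i'\<in>B. vertex_sum ?H ?f (Xv i' j))"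
      unfolding sum_g by (simp add: sum.reindex inj_on_def)
    also have "\<dots> = (\<Sum>i'\<in>B. Gamma_sigma n k j i')"
    proof (rule sum.cong)
      fix i' assume "i' \<in> B"
      then have "i' \<in> {1..2*k+1}" using B(1) partition_onD1[OF part] by blast
      then show "vertex_sum ?H ?f (Xv i' j) = Gamma_sigma n k j i'"
        unfolding Gamma_sigma_def using ij(2) by (rule vertex_sum_Gamma_Xv)
    qed simp
    also have "\<dots> = c" using P[OF ij(2)] B(1) unfolding admissible_partition_def c_def by blast
    finally show ?thesis .
  qed
  have neq: "a \<noteq> b" "a \<noteq> c" "b \<noteq> c"
    unfolding a_def b_def c_def using sums_neq[OF assms(2,4)] by blast+
  have "bij_betw g (edges G) {1..(2*k+1)*(4*n+3)}"
    unfolding g_def by (rule bij_betw_push_label[OF E inj bij_betw_Gamma_label])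
  moreover from this have "card (edges G) = (2*k+1)*(4*n+3)"
    using bij_betw_same_card by fastforce
  moreover have "vertex_sum G g x \<noteq> vertex_sum G g y" if "{x, y} \<in> edges G" for x y
  proof -
    obtain e where e: "e \<in> edges ?H" "{x, y} = p ` e" using \<open>{x, y} \<in> edges G\<close> E by blast
    \<comment> \<open>Stated for unordered pairs, since the equation for \<open>{x, y}\<close> does
      not tell which of the two is the image of which end of \<open>e\<close>.\<close>
    from e(1) have "{vertex_sum G g x, vertex_sum G g y} \<in> {{a, b}, {a, c}, {b, c}}"
    proof (cases rule: edges_Gamma_cases)
      case (uv i)
      then show ?thesis using e(2) U W by (auto simp: doubleton_eq_iff)
    next
      case (ux i j)
      then show ?thesis using e(2) U X by (auto simp: doubleton_eq_iff)
    next
      case (vx i j)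
      then show ?thesis using e(2) W X by (auto simp: doubleton_eq_iff)
    qed
    then show ?thesis using neq by (auto simp: doubleton_eq_iff)
  qed
  ultimately have "local_antimagic G g" unfolding local_antimagic_def by simp
  then have "chi_la G \<le> enat (card (vertex_sum G g ` verts G))"
    unfolding chi_la_def by (intro INF_lower) simp
  also have "vertex_sum G g ` verts G \<subseteq> {a, b, c}"
  proof
    fix z assume "z \<in> vertex_sum G g ` verts G"
    then obtain y where "y \<in> verts ?H" "z = vertex_sum G g (p y)" unfolding V by blast
    then show "z \<in> {a, b, c}" by (cases y) (use U W X in auto)
  qed
  then have "card (vertex_sum G g ` verts G) \<le> card {a, b, c}"
    by (intro card_mono) auto
  then have "enat (card (vertex_sum G g ` verts G)) \<le> 3"
    using neq by (simp add: numeral_eq_enat)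
  finally have "chi_la G \<le> 3" .
  moreover have "3 \<le> chi_la G"
  proof (rule three_le_chi_la_if_triangle)
    show "finite (verts G)" unfolding V using finite_verts_Gamma by (rule finite_imageI)
    show "p (Uv 1) \<in> verts G" "p (Vv 1) \<in> verts G" "p (Xv 1 1) \<in> verts G"
      unfolding V by (auto intro!: imageI)
    show "{p (Uv 1), p (Vv 1)} \<in> edges G"
      unfolding E using imageI[OF edges_GammaI(1)[of 1 k n], of "(`) p"] by simp
    show "{p (Uv 1), p (Xv 1 1)} \<in> edges G"
      unfolding E using imageI[OF edges_GammaI(2)[of 1 k 1 n], of "(`) p"] by simp
    show "{p (Vv 1), p (Xv 1 1)} \<in> edges G"
      unfolding E using imageI[OF edges_GammaI(3)[of 1 k 1 n], of "(`) p"] by simp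
  qed
  ultimately show ?thesis by (rule antisym)
qed

end
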